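(* Let $f,g:[a,b]\to\mathbb{R}$ be integrable functions such that $0\le g(t)\le 1$ for all $t\in[a,b]$ and such that $\int_a^b g(t)\,df(t)$ exists. Put $\lambda:=\int_a^b g(t)\,dt$. If $f$ is monotonic nondecreasing on $[a,b]$, then $$\left|\int_a^{a+\lambda} f(t)\,dt-\int_a^b f(t)g(t)\,dt\right|\le\lambda\left[f(a+\lambda)-f(a)\right]+(b-a-\lambda)\left[f(b)-f(a+\lambda)\right],$$ and $$\left|\int_a^b f(t)g(t)\,dt-\int_{b-\lambda}^b f(t)\,dt\right|\le\lambda\left[f(b)-f(b-\lambda)\right]+(b-a-\lambda)\left[f(b-\lambda)-f(a)\right].$$
   Context: Here $a<b$ are real numbers and $\int_a^b g(t)\,df(t)$ denotes the Riemann–Stieltjes integral of $g$ with respect to $f$. *)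

theory Defs
  imports "HOL-Analysis.Analysis"
begin

text \<open>
  The Riemann--Stieltjes integral of \<open>g\<close> with respect to \<open>f\<close>, as the limit of the
  sums \<open>\<Sum> g \<xi> * (f (Sup K) - f (Inf K))\<close> when the mesh of the division tends to 0.
  A tagged division is a set of pairs \<open>(\<xi>, K)\<close> with \<open>K\<close> a nonempty compact interval
  containing \<open>\<xi>\<close>; the end points of \<open>K\<close> are \<open>Inf K\<close> and \<open>Sup K\<close>.
  One-point intervals are allowed, but they contribute 0 to the sum.
\<close>

definition has_RS_integral ::
  "(real \<Rightarrow> real) \<Rightarrow> (real \<Rightarrow> real) \<Rightarrow> real \<Rightarrow> real \<Rightarrow> real \<Rightarrow> bool" where
  "has_RS_integral g f a b I \<longleftrightarrow>
    (\<forall>\<epsilon>>0. \<exists>\<delta>>0. \<forall>p. p tagged_division_of {a..b} \<and> (\<forall>(\<xi>, K)\<in>p. Sup K - Inf K < \<delta>) \<longrightarrow>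
      \<bar>(\<Sum>(\<xi>, K)\<in>p. g \<xi> * (f (Sup K) - f (Inf K))) - I\<bar> < \<epsilon>)"

definition RS_integrable ::
  "(real \<Rightarrow> real) \<Rightarrow> (real \<Rightarrow> real) \<Rightarrow> real \<Rightarrow> real \<Rightarrow> bool" where
  "RS_integrable g f a b \<longleftrightarrow> (\<exists>I. has_RS_integral g f a b I)"

end

theory Submission
  imports Defs
begin

text \<open>
  Both inequalities compare \<open>\<integral> f g\<close> with \<open>\<integral> f u\<close>, where \<open>u\<close> is the indicator of a subinterval
  of length \<open>\<lambda> = \<integral> g\<close>. As \<open>\<integral> u = \<integral> g\<close>, the difference is \<open>\<integral> (f - f c) (u - g)\<close> for every constant
  \<open>f c\<close>; since \<open>\<bar>u - g\<bar> \<le> 1\<close>, monotonicity of \<open>f\<close> bounds it on \<open>[a, c]\<close> and on \<open>[c, b]\<close>. Choose \<open>c\<close> to be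
  the end point of the subinterval inside \<open>[a, b]\<close>.
\<close>

text \<open>The second mean value theorem, with \<open>f\<close> as the monotone factor, gives the
  product an explicit integral.\<close>

lemma integrable_mono_on_mult:
  fixes f g :: "real \<Rightarrow> real"
  assumes f: "mono_on {a..b} f" and g: "g integrable_on {a..b}"
  shows "(\<lambda>t. f t * g t) integrable_on {a..b}"
proof (cases "a \<le> b")
  case True
  have "f x \<le> f y" if "a \<le> x" "x \<le> y" "y \<le> b" for x y
    using that monotone_onD[OF f, of x y] by simp
  then show ?thesis
    by (rule second_mean_value_theorem_full[OF g True]) (auto simp: integrable_on_def)
qed (simp add: integrable_on_empty)

lemma mono_on_integral_mult_diff_le:
  fixes f g u :: "real \<Rightarrow> real"
  assumes f: "mono_on {a..b} f" and c: "a \<le> c" "c \<le> b"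
    and g: "g integrable_on {a..b}" "\<And>t. t \<in> {a..b} \<Longrightarrow> 0 \<le> g t \<and> g t \<le> 1"
    and u: "u integrable_on {a..b}" "\<And>t. t \<in> {a..b} \<Longrightarrow> 0 \<le> u t \<and> u t \<le> 1"
    and eq: "integral {a..b} u = integral {a..b} g"
  shows "\<bar>integral {a..b} (\<lambda>t. f t * u t) - integral {a..b} (\<lambda>t. f t * g t)\<bar>
    \<le> (c - a) * (f c - f a) + (b - c) * (f b - f c)"
proof -
  \<comment> \<open>This is \<open>(f t - f c) * (u t - g t)\<close>, multiplied out so that
    linearity splits its integral; the \<open>f c\<close> terms cancel by \<open>eq\<close>.\<close>
  define h where "h t = f t * u t - f t * g t - (f c * u t - f c * g t)" for t
  have fu: "(\<lambda>t. f t * u t) integrable_on {a..b}" and fg: "(\<lambda>t. f t * g t) integrable_on {a..b}"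
    using f g u by (auto intro: integrable_mono_on_mult)
  have cu: "(\<lambda>t. f c * u t) integrable_on {a..b}" and cg: "(\<lambda>t. f c * g t) integrable_on {a..b}"
    using g u by (auto intro: integrable_on_mult_right)
  have h: "h integrable_on {a..b}"
    unfolding h_def by (intro integrable_diff fu fg cu cg)
  have "integral {a..b} h
      = integral {a..b} (\<lambda>t. f t * u t) - integral {a..b} (\<lambda>t. f t * g t)"
    unfolding h_def by (simp add: integral_diff integrable_diff fu fg cu cg eq)
  moreover have "integral {a..c} h + integral {c..b} h = integral {a..b} h"
    by (rule Henstock_Kurzweil_Integration.integral_combine[OF c h])
  moreover have abs_h: "\<bar>h t\<bar> \<le> \<bar>f t - f c\<bar>" if "t \<in> {a..b}" for t
  proof -
    have "h t = (f t - f c) * (u t - g t)"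
      by (simp add: h_def algebra_simps)
    moreover have "\<bar>u t - g t\<bar> \<le> 1"
      using g(2)[OF that] u(2)[OF that] by linarith
    ultimately show ?thesis
      by (simp add: abs_mult mult_left_le)
  qed
  \<comment> \<open>Splitting at \<open>c\<close> fixes the sign of \<open>f t - f c\<close>: to its
    left \<open>\<bar>f t - f c\<bar> = f c - f t\<close>, to its right it is
    \<open>f t - f c\<close>.\<close>
  moreover have "norm (integral {a..c} h) \<le> (f c - f a) * measure lborel {a..c}"
  proof (rule has_integral_bound_real[where S = "{}"])
    show "(h has_integral integral {a..c} h) {a..c}"
      using c by (intro integrable_integral integrable_on_subinterval[OF h]) auto
    show "norm (h t) \<le> f c - f a" if "t \<in> {a..c} - {}" for t
      using that c abs_h[of t] monotone_onD[OF f, of a t] monotone_onD[OF f, of t c] by auto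
  qed (use c monotone_onD[OF f, of a c] in auto)
  moreover have "norm (integral {c..b} h) \<le> (f b - f c) * measure lborel {c..b}"
  proof (rule has_integral_bound_real[where S = "{}"])
    show "(h has_integral integral {c..b} h) {c..b}"
      using c by (intro integrable_integral integrable_on_subinterval[OF h]) auto
    show "norm (h t) \<le> f b - f c" if "t \<in> {c..b} - {}" for t
      using that c abs_h[of t] monotone_onD[OF f, of t b] monotone_onD[OF f, of c t] by auto
  qed (use c monotone_onD[OF f, of c b] in auto)
  ultimately show ?thesis
    using c by (simp add: mult.commute)
qed

text \<open>Here \<open>u\<close> becomes the indicator of \<open>{p..q}\<close>. The point
  \<open>c\<close> stays free, so that it can be \<open>q\<close> for the left subinterval and
  \<open>p\<close> for the right one.\<close>

lemma mono_on_integral_subinterval_diff_le: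
  fixes f g :: "real \<Rightarrow> real"
  assumes f: "mono_on {a..b} f" and c: "a \<le> c" "c \<le> b"
    and g: "g integrable_on {a..b}" "\<And>t. t \<in> {a..b} \<Longrightarrow> 0 \<le> g t \<and> g t \<le> 1"
    and pq: "a \<le> p" "p \<le> q" "q \<le> b" "integral {a..b} g = q - p"
  shows "\<bar>integral {p..q} f - integral {a..b} (\<lambda>t. f t * g t)\<bar>
    \<le> (c - a) * (f c - f a) + (b - c) * (f b - f c)"
proof -
  define u :: "real \<Rightarrow> real" where "u t = (if t \<in> {p..q} then 1 else 0)" for t
  have fu: "(\<lambda>t. f t * u t) = (\<lambda>t. if t \<in> {p..q} then f t else 0)"
    by (auto simp: u_def)
  have sub: "{p..q} \<inter> {a..b} = {p..q}"
    using pq by auto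
  have u: "(u has_integral q - p) {a..b}"
    using has_integral_restrict[of "{p..q}" "{a..b}" "\<lambda>_. 1 :: real" "q - p"] pq
      has_integral_const_real[of "1 :: real" p q] by (simp add: u_def[abs_def])
  have "integral {a..b} (\<lambda>t. f t * u t) = integral {p..q} f"
    unfolding fu integral_restrict_Int sub ..
  then show ?thesis
    using mono_on_integral_mult_diff_le[OF f c g, of u] u pq(4)
    by (auto simp: u_def integral_unique integrable_on_def)
qed

theorem theorem5:
  fixes f g :: "real \<Rightarrow> real" and a b lam :: real
  assumes "a < b"
    and "f integrable_on {a..b}"
    and "g integrable_on {a..b}"
    and "\<And>t. t \<in> {a..b} \<Longrightarrow> 0 \<le> g t \<and> g t \<le> 1"
    and "RS_integrable g f a b"
    and "lam = integral {a..b} g"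
    and "mono_on {a..b} f"
  shows "\<bar>integral {a..a + lam} f - integral {a..b} (\<lambda>t. f t * g t)\<bar>
           \<le> lam * (f (a + lam) - f a) + (b - a - lam) * (f b - f (a + lam))
       \<and> \<bar>integral {a..b} (\<lambda>t. f t * g t) - integral {b - lam..b} f\<bar>
           \<le> lam * (f b - f (b - lam)) + (b - a - lam) * (f (b - lam) - f a)"
proof -
  \<comment> \<open>The two bounds on \<open>lam\<close> keep both subintervals inside
    \<open>{a..b}\<close>.\<close>
  have "0 \<le> lam"
    using assms by (auto intro: integral_nonneg)
  moreover have "lam \<le> b - a"
    using integral_le[OF assms(3) integrable_const_ivl[of 1]] assms by simp
  \<comment> \<open>For \<open>c = a + lam\<close> the weights \<open>c - a\<close> and
    \<open>b - c\<close> are \<open>lam\<close> and \<open>b - a - lam\<close>; for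
    \<open>c = b - lam\<close> they trade places, hence \<open>add.commute\<close>.\<close>
  ultimately show ?thesis
    using mono_on_integral_subinterval_diff_le[OF assms(7) _ _ assms(3,4), of "a + lam" a "a + lam"]
      mono_on_integral_subinterval_diff_le[OF assms(7) _ _ assms(3,4), of "b - lam" "b - lam" b]
    by (simp add: assms(6)[symmetric] abs_minus_commute[of "integral {a..b} (\<lambda>t. f t * g t)"] diff_diff_eq add.commute)
qed

end
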